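(* Let $A\in\mathbb{R}^{m\times p}$, $B\in\mathbb{R}^{q\times n}$ and $C\in\mathbb{R}^{m\times n}$ be such that the matrix equation $AXB=C$ is consistent (i.e. has a solution $X\in\mathbb{R}^{p\times q}$). Assume that $0<\alpha<\frac{2}{\|B\|_2^2}$. Then for an arbitrary initial matrix $X^0\in\mathbb{R}^{p\times q}$, the sequence $\{X^k\}_{k=0}^\infty$ generated by the ME-BK method $$X^{k+1}=X^k+\frac{\alpha}{\|A_{i_k,:}\|_2^2}\,A_{i_k,:}^T\left(C_{i_k,:}-A_{i_k,:}X^kB\right)B^T,\qquad i_k=(k \bmod m)+1,\qquad k=0,1,2,\ldots,$$ converges to $$X_*^0:=A^+CB^++X^0-A^+AX^0BB^+ .$$
   Context: For a real matrix $M$: $M^T$ is the transpose, $M^+$ the Moore–Penrose inverse, $\|M\|_2$ the spectral norm (Euclidean norm for row or column vectors), and $M_{i,:}$ the $i$-th row (a row vector). $(k\bmod m)$ is the remainder of $k$ divided by $m$. All rows of $A$ are nonzero, so that the iteration is well defined, and $B\neq 0$. *)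

theory Defs
  imports "HOL-Analysis.Analysis"
begin

definition spectral_norm :: "real^'n^'m \<Rightarrow> real"
  where "spectral_norm M = onorm (\<lambda>x. M *v x)"

abbreviation row_mat :: "'m \<Rightarrow> 'a^'n^'m \<Rightarrow> 'a^'n^1"
  where "row_mat i M \<equiv> rowvector (row i M)"

text \<open>The four Penrose conditions; they determine \<open>G\<close> uniquely.\<close>

definition is_pinv :: "real^'n^'m \<Rightarrow> real^'m^'n \<Rightarrow> bool"
  where "is_pinv M G \<longleftrightarrow>
    M ** G ** M = M \<and> G ** M ** G = G \<and>
    transpose (M ** G) = M ** G \<and> transpose (G ** M) = G ** M"

definition pinv :: "real^'n^'m \<Rightarrow> real^'m^'n"
  where "pinv M = (THE G. is_pinv M G)"

lemma is_pinv_unique: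
  fixes M :: "real^'n^'m"
  assumes "is_pinv M G" and "is_pinv M H"
  shows "G = H"
proof -
  have g: "M ** G ** M = M" "G ** M ** G = G"
      "transpose (M ** G) = M ** G" "transpose (G ** M) = G ** M"
    and h: "M ** H ** M = M" "H ** M ** H = H"
      "transpose (M ** H) = M ** H" "transpose (H ** M) = H ** M"
    using assms by (auto simp: is_pinv_def)
  have "M ** G = M ** H ** (M ** G)"
    by (metis h(1) matrix_mul_assoc)
  also have "\<dots> = transpose (M ** G ** (M ** H))"
    by (simp add: matrix_transpose_mul[of "M ** G"] g(3) h(3))
  also have "M ** G ** (M ** H) = M ** H"
    by (metis g(1) matrix_mul_assoc)
  finally have 1: "M ** G = M ** H"
    by (simp add: h(3))
  have "G ** M = G ** M ** (H ** M)"
    by (metis h(1) matrix_mul_assoc)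
  also have "\<dots> = transpose (H ** M ** (G ** M))"
    by (simp add: matrix_transpose_mul[of "H ** M"] g(4) h(4))
  also have "H ** M ** (G ** M) = H ** M"
    by (metis g(1) matrix_mul_assoc)
  finally have 2: "G ** M = H ** M"
    by (simp add: h(4))
  show ?thesis
    by (metis 1 2 g(2) h(2) matrix_mul_assoc)
qed

lemma transpose_gram_left_inverse:
  fixes M :: "real^'n^'m"
  obtains L where "L ** transpose M ** M = M"
proof -
  let ?S = "range (\<lambda>x. M *v x)"
  have S: "subspace ?S"
    by (intro linear_subspace_image) (auto intro: matrix_vector_mul_linear)
  have inj: "inj_on (\<lambda>y. transpose M *v y) ?S"
  proof (rule inj_onI)
    fix y z assume "y \<in> ?S" "z \<in> ?S" and eq: "transpose M *v y = transpose M *v z"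
    then have "y - z \<in> ?S"
      using S subspace_diff by blast
    then obtain x where x: "y - z = M *v x" by blast
    have "transpose M *v (y - z) = 0"
      using eq by (simp add: matrix_vector_mult_diff_distrib)
    then have "(y - z) \<bullet> (M *v x) = 0"
      by (metis dot_lmul_matrix inner_zero_left transpose_matrix_vector transpose_transpose)
    then show "y = z"
      using x by (metis eq_iff_diff_eq_0 inner_eq_zero_iff)
  qed
  obtain g where g: "linear g" "\<And>v. v \<in> ?S \<Longrightarrow> g (transpose M *v v) = v"
    using linear_exists_left_inverse_on[OF matrix_vector_mul_linear S inj] by auto
  have "(matrix g ** transpose M ** M) *v x = M *v x" for x
    using g by (simp add: matrix_vector_mul_assoc[symmetric] matrix_works)
  then have "matrix g ** transpose M ** M = M"
    by (simp add: matrix_eq)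
  then show ?thesis by (rule that)
qed

lemma is_pinv_exists:
  fixes M :: "real^'n^'m"
  shows "\<exists>G. is_pinv M G"
proof -
  have aux: "\<exists>Q. N ** Q ** N = N \<and> transpose (N ** Q) = N ** Q"
    for N :: "real^'k^'l"
  proof -
    obtain L where L: "L ** transpose N ** N = N"
      by (rule transpose_gram_left_inverse)
    define Q where "Q = transpose L"
    have t: "transpose (N ** Q) = L ** transpose N"
      by (simp add: Q_def matrix_transpose_mul)
    then have P: "transpose (N ** Q) ** N = N"
      using L by simp
    then have "transpose (N ** Q) ** (N ** Q) = N ** Q"
      by (simp add: matrix_mul_assoc)
    then have s: "transpose (N ** Q) = N ** Q"
      by (metis matrix_transpose_mul transpose_transpose)
    then show ?thesis using P by auto
  qed
  obtain Q where Q: "M ** Q ** M = M" "transpose (M ** Q) = M ** Q"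
    using aux by blast
  obtain R' where R': "transpose M ** R' ** transpose M = transpose M"
      "transpose (transpose M ** R') = transpose M ** R'"
    using aux by blast
  define R where "R = transpose R'"
  have R: "M ** R ** M = M" "transpose (R ** M) = R ** M"
    using R' unfolding R_def
    by (metis matrix_mul_assoc matrix_transpose_mul transpose_transpose)+
  define G where "G = R ** M ** Q"
  have MG: "M ** G = M ** Q" and GM: "G ** M = R ** M"
    unfolding G_def using Q(1) R(1) by (metis matrix_mul_assoc)+
  have "G ** M ** G = G"
    unfolding GM unfolding G_def using R(1) by (metis matrix_mul_assoc)
  then have "is_pinv M G"
    unfolding is_pinv_def MG GM using Q R by simp
  then show ?thesis by blast
qed

lemma is_pinv_pinv: "is_pinv M (pinv M)"
  unfolding pinv_def by (metis is_pinv_exists is_pinv_unique theI)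

end

theory Submission
  imports Defs
begin

text \<open>
  With \<open>L\<close> the claimed limit, consistency gives \<open>A L B = C\<close>, so the error \<open>E = X - L\<close> evolves by the
  linear maps \<open>T\<^sub>l E = E - (\<alpha> / \<parallel>a\<parallel>\<^sup>2) a\<^sup>T a E B B\<^sup>T\<close>, where \<open>a\<close> is the \<open>l\<close>-th row of \<open>A\<close>.
  In the Frobenius norm
  \<open>\<parallel>T\<^sub>l E\<parallel>\<^sup>2 = \<parallel>E\<parallel>\<^sup>2 - (\<alpha> / \<parallel>a\<parallel>\<^sup>2) (2 \<parallel>a E B\<parallel>\<^sup>2 - \<alpha> \<parallel>a E B B\<^sup>T\<parallel>\<^sup>2)\<close>,
  which is smaller than \<open>\<parallel>E\<parallel>\<^sup>2\<close> unless \<open>a E B = 0\<close>. The errors stay in the space of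
  matrices \<open>E = A\<^sup>+ A E B B\<^sup>+\<close>, in which only \<open>0\<close> satisfies \<open>A E B = 0\<close>, that is, only \<open>0\<close> is
  fixed by every \<open>T\<^sub>l\<close>. A compactness argument then gives convergence to \<open>0\<close>.
\<close>

text \<open>The norms decrease to some \<open>\<rho>\<close>, and every point on the orbit of a
  cluster point \<open>x\<close> of the bounded sequence has norm \<open>\<rho>\<close>. The
  strictness hypothesis then makes each map fix \<open>x\<close>, so \<open>x\<close> and
  \<open>\<rho>\<close> are 0.\<close>

lemma periodic_nonexpansive_tendsto_0:
  fixes T :: "nat \<Rightarrow> 'a::{real_normed_vector, heine_borel} \<Rightarrow> 'a"
  assumes S: "closed S" "\<And>k x. x \<in> S \<Longrightarrow> T k x \<in> S"
    and cont: "\<And>k. continuous_on UNIV (T k)"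
    and periodic: "\<And>k. T (k + N) = T k" and N: "N > 0"
    and nonexp: "\<And>k x. norm (T k x) \<le> norm x"
    and strict: "\<And>k x. norm (T k x) = norm x \<Longrightarrow> T k x = x"
    and fixed: "\<And>x. x \<in> S \<Longrightarrow> (\<And>k. T k x = x) \<Longrightarrow> x = 0"
    and e0: "e 0 \<in> S" and e_Suc: "\<And>k. e (Suc k) = T k (e k)"
  shows "e \<longlonglongrightarrow> 0"
proof -
  have eS: "e k \<in> S" for k
    by (induction k) (auto simp: e0 e_Suc S(2))
  have dec: "decseq (\<lambda>k. norm (e k))"
    by (intro decseq_SucI) (simp add: e_Suc nonexp)
  then obtain \<rho> where \<rho>: "(\<lambda>k. norm (e k)) \<longlonglongrightarrow> \<rho>"
    using decseq_convergent[OF dec, of 0] by auto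
  \<comment> \<open>Sampling at multiples of \<open>N\<close> lets periodicity apply: from every
    sampled index onwards the maps \<open>T 0\<close>, \<open>T 1\<close>, ... act in the same
    order.\<close>
  have "bounded (range (\<lambda>j. e (j * N)))"
    by (rule boundedI[of _ "norm (e 0)"]) (use decseqD[OF dec, of 0] in auto)
  then obtain x \<phi> where \<phi>: "strict_mono (\<phi> :: nat \<Rightarrow> nat)" and x: "(\<lambda>j. e (\<phi> j * N)) \<longlonglongrightarrow> x"
    using bounded_imp_convergent_subsequence[of "\<lambda>j. e (j * N)"] by (auto simp: o_def)
  have "x \<in> S"
    using closed_sequentially[OF S(1) _ x] eS by simp
  have T_mult: "T (k + j * N) = T k" for k j
  proof (induction j)
    case (Suc j)
    then show ?case
      using periodic[of "k + j * N"] by (simp add: ac_simps)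
  qed simp
  \<comment> \<open>The orbit of \<open>x\<close> is a limit of shifts of \<open>e\<close>, so the norm is constant along it.\<close>
  define U where "U = rec_nat x (\<lambda>k y. T k y)"
  have U: "U 0 = x" "U (Suc k) = T k (U k)" for k
    by (simp_all add: U_def)
  have lim_U: "(\<lambda>j. e (k + \<phi> j * N)) \<longlonglongrightarrow> U k" for k
  proof (induction k)
    case (Suc k)
    have "(\<lambda>j. T k (e (k + \<phi> j * N))) \<longlonglongrightarrow> T k (U k)"
      by (rule isCont_tendsto_compose[OF _ Suc])
         (use cont[of k] in \<open>simp add: continuous_on_eq_continuous_at\<close>)
    then show ?case
      by (simp add: e_Suc T_mult U)
  qed (simp add: U x)
  have norm_U: "norm (U k) = \<rho>" for k
  proof (rule LIMSEQ_unique)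
    show "(\<lambda>j. norm (e (k + \<phi> j * N))) \<longlonglongrightarrow> norm (U k)"
      by (intro tendsto_norm lim_U)
    have "strict_mono (\<lambda>j. k + \<phi> j * N)"
      using \<phi> N by (simp add: strict_mono_def)
    from LIMSEQ_subseq_LIMSEQ[OF \<rho> this]
    show "(\<lambda>j. norm (e (k + \<phi> j * N))) \<longlonglongrightarrow> \<rho>"
      by (simp add: o_def)
  qed
  \<comment> \<open>Both \<open>U k\<close> and its image \<open>U (Suc k)\<close> have norm
    \<open>\<rho>\<close>.\<close>
  have fix_U: "T k (U k) = U k" for k
    by (intro strict) (simp add: norm_U flip: U(2))
  then have "U k = x" for k
    by (induction k) (auto simp: U)
  with fix_U have "x = 0"
    by (intro fixed[OF \<open>x \<in> S\<close>]) simp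
  with norm_U[of 0] have "\<rho> = 0"
    by (simp add: U)
  with \<rho> show ?thesis
    by (simp add: tendsto_norm_zero_iff)
qed

text \<open>The inner product on matrices as nested vectors is the Frobenius one; both sides are the
  same triple sum, taken in different orders.\<close>

lemma inner_matrix_mult_left:
  fixes M :: "real^'n^'m"
  shows "(M ** F) \<bullet> E = F \<bullet> (transpose M ** E)"
proof -
  have "(M ** F) \<bullet> E = (\<Sum>i\<in>UNIV. \<Sum>k\<in>UNIV. M $ i $ k * (F $ k \<bullet> E $ i))"
    by (simp add: inner_vec_def matrix_matrix_mult_def sum_distrib_left sum_distrib_right mult.assoc)
       (intro sum.cong refl sum.swap)
  also have "\<dots> = (\<Sum>k\<in>UNIV. \<Sum>i\<in>UNIV. M $ i $ k * (F $ k \<bullet> E $ i))"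
    by (rule sum.swap)
  also have "\<dots> = F \<bullet> (transpose M ** E)"
    by (simp add: inner_vec_def matrix_matrix_mult_def transpose_def sum_distrib_left mult.left_commute)
       (intro sum.cong refl sum.swap)
  finally show ?thesis .
qed

lemma inner_transpose:
  fixes E :: "real^'n^'m"
  shows "transpose E \<bullet> transpose F = E \<bullet> F"
  unfolding inner_vec_def transpose_def by (simp, rule sum.swap)

lemma inner_matrix_mult_right:
  fixes N :: "real^'n^'m"
  shows "(F ** N) \<bullet> E = F \<bullet> (E ** transpose N)"
  using inner_matrix_mult_left[of "transpose N" "transpose F" "transpose E"]
  by (simp add: inner_transpose flip: matrix_transpose_mul)
     (metis inner_transpose matrix_transpose_mul transpose_transpose)

text \<open>The rows of \<open>M ** transpose B\<close> are the images under \<open>B\<close> of the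
  rows of \<open>M\<close>, so the operator norm bounds each of them, and the squared bounds add up
  to the Frobenius norm.\<close>

lemma norm_matrix_mult_transpose_le:
  fixes M :: "real^'n^'m" and B :: "real^'n^'q"
  shows "norm (M ** transpose B) \<le> spectral_norm B * norm M"
proof -
  have row: "(M ** transpose B) $ i = B *v (M $ i)" for i
    by (simp add: vec_eq_iff matrix_matrix_mult_def matrix_vector_mult_def transpose_def mult.commute)
  have "norm ((M ** transpose B) $ i) \<le> spectral_norm B * norm (M $ i)" for i
    unfolding row spectral_norm_def by (rule onorm) (rule matrix_vector_mul_bounded_linear)
  then have "norm (M ** transpose B) \<le> L2_set (\<lambda>i. spectral_norm B * norm (M $ i)) UNIV"
    unfolding norm_vec_def[of "M ** transpose B"] by (intro L2_set_mono) auto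
  also have "\<dots> = spectral_norm B * norm M"
    by (simp add: norm_vec_def[of M] L2_set_right_distrib spectral_norm_def onorm_pos_le
        matrix_vector_mul_bounded_linear)
  finally show ?thesis .
qed

lemma row_mat_mult:
  fixes M :: "real^'n^'m"
  shows "row_mat l (M ** N) = row_mat l M ** N"
  by (simp add: vec_eq_iff rowvector_def row_def matrix_matrix_mult_def)

lemma matrix_eq_0_iff_row_mat: "M = 0 \<longleftrightarrow> (\<forall>l. row_mat l M = 0)"
  for M :: "real^'n^'m"
  by (auto simp: vec_eq_iff rowvector_def row_def)

lemma row_mat_mult_transpose:
  fixes M :: "real^'n^'m"
  shows "row_mat l M ** transpose (row_mat l M) = (norm (row l M))\<^sup>2 *\<^sub>R mat 1"
  unfolding power2_norm_eq_inner
  by (auto simp: vec_eq_iff rowvector_def row_def matrix_matrix_mult_def transpose_def mat_def inner_vec_def)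

lemma matrix_add_rdistrib: "(M + N) ** K = M ** K + N ** K"
  for M N :: "real^'n^'m"
  by (simp add: vec_eq_iff matrix_matrix_mult_def sum.distrib distrib_right)

lemma linear_matrix_sandwich: "linear (\<lambda>X. M ** X ** N)"
  for M :: "real^'n^'m" and N :: "real^'q^'p"
  by (intro linearI)
     (simp_all add: matrix_add_ldistrib matrix_add_rdistrib matrix_scalar_ac scalar_matrix_assoc)

theorem theorem3p3:
  fixes A :: "real^'p^'m" and B :: "real^'n^'q" and C :: "real^'n^'m"
    and \<alpha> :: real and X0 :: "real^'q^'p" and X :: "nat \<Rightarrow> real^'q^'p"
    and r :: "nat \<Rightarrow> 'm" and i :: "nat \<Rightarrow> 'm"
  assumes enum: "bij_betw r {1..CARD('m)} UNIV"
    and cyclic: "\<And>k. i k = r (k mod CARD('m) + 1)"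
    and rows_nonzero: "\<And>l. row l A \<noteq> 0"
    and B_nonzero: "B \<noteq> 0"
    and consistent: "\<exists>Y :: real^'q^'p. A ** Y ** B = C"
    and alpha: "0 < \<alpha>" "\<alpha> < 2 / (spectral_norm B)\<^sup>2"
    and X_init: "X 0 = X0"
    and X_step: "\<And>k. X (Suc k) = X k +
      (\<alpha> / (norm (row (i k) A))\<^sup>2) *\<^sub>R
        (transpose (row_mat (i k) A) ** (row_mat (i k) C - row_mat (i k) A ** X k ** B) ** transpose B)"
  shows "X \<longlonglongrightarrow> pinv A ** C ** pinv B + X0 - pinv A ** A ** X0 ** B ** pinv B"
proof -
  define P where "P l = (row_mat l A :: real^'p^1)" for l
  define c where "c l = \<alpha> / (norm (row l A))\<^sup>2" for l
  define T where "T l E = E - c l *\<^sub>R (transpose (P l) ** (P l ** E ** B) ** transpose B)"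
    for l and E :: "real^'q^'p"
  \<comment> \<open>\<open>F\<close> projects onto the space in which the errors live. The limit
    \<open>L\<close> takes its \<open>F\<close> part from a solution \<open>Y\<close> and the
    complementary part from \<open>X0\<close>.\<close>
  define F where "F E = pinv A ** A ** E ** (B ** pinv B)" for E :: "real^'q^'p"
  define L where "L = pinv A ** C ** pinv B + X0 - F X0"
  obtain Y where Y: "A ** Y ** B = C"
    using consistent by blast
  have pA: "A ** pinv A ** A = A" "pinv A ** A ** pinv A = pinv A"
      "transpose (pinv A ** A) = pinv A ** A"
    and pB: "B ** pinv B ** B = B" "transpose (B ** pinv B) = B ** pinv B"
    using is_pinv_pinv[of A] is_pinv_pinv[of B] by (simp_all add: is_pinv_def)
  have pA': "pinv A ** A ** (pinv A ** A) = pinv A ** A"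
    and pB': "B ** pinv B ** (B ** pinv B) = B ** pinv B"
    by (simp_all only: matrix_mul_assoc pA pB)
  have lin_F: "linear F"
    unfolding F_def by (rule linear_matrix_sandwich)
  have AFB: "A ** F E ** B = A ** E ** B" for E
  proof -
    have "A ** F E ** B = A ** pinv A ** A ** E ** (B ** pinv B ** B)"
      by (simp only: F_def matrix_mul_assoc)
    then show ?thesis
      by (simp only: pA pB)
  qed
  have FF: "F (F E) = F E" for E
  proof -
    have "F (F E) = pinv A ** A ** (pinv A ** A) ** E ** (B ** pinv B ** (B ** pinv B))"
      by (simp only: F_def matrix_mul_assoc)
    then show ?thesis
      by (simp only: F_def pA' pB')
  qed
  have L: "L = F Y + X0 - F X0"
    unfolding L_def F_def Y[symmetric] by (simp add: matrix_mul_assoc)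
  have lin_AB: "linear (\<lambda>E. A ** E ** B)"
    by (rule linear_matrix_sandwich)
  have "A ** L ** B = C"
    unfolding L linear_diff[OF lin_AB] linear_add[OF lin_AB] AFB Y by simp
  then have PLB: "P l ** L ** B = row_mat l C" for l
    unfolding P_def by (simp flip: row_mat_mult)
  \<comment> \<open>Transposing \<open>A ** pinv A ** A = A\<close> row by row, and likewise the
    identity for \<open>B\<close>, shows that every correction lies in the range of
    \<open>F\<close>; hence the errors never leave it.\<close>
  have F_update: "F (transpose (P l) ** D ** transpose B) = transpose (P l) ** D ** transpose B"
    for l D
  proof -
    have "P l ** (pinv A ** A) = P l"
      using pA(1) unfolding P_def by (simp add: matrix_mul_assoc flip: row_mat_mult)
    then have P: "pinv A ** A ** transpose (P l) = transpose (P l)"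
      using matrix_transpose_mul[of "P l" "pinv A ** A"] by (simp only: pA)
    have Q: "transpose B ** (B ** pinv B) = transpose B"
      using matrix_transpose_mul[of "B ** pinv B" B] by (simp only: pB)
    have "F (transpose (P l) ** D ** transpose B)
        = pinv A ** A ** transpose (P l) ** D ** (transpose B ** (B ** pinv B))"
      by (simp only: F_def matrix_mul_assoc)
    then show ?thesis
      by (simp only: P Q)
  qed
  \<comment> \<open>Since \<open>row_mat l C = P l ** L ** B\<close>, the residual is minus the
    corresponding product for the error.\<close>
  have step: "X (Suc k) - L = T (i k) (X k - L)" for k
  proof -
    have "P l ** (X k - L) ** B = P l ** X k ** B - row_mat l C" for l
      by (simp add: linear_diff[OF linear_matrix_sandwich] PLB)
    then show ?thesis
      unfolding X_step T_def P_def[symmetric] c_def[symmetric]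
      by (simp add: linear_diff[OF linear_matrix_sandwich] linear_neg algebra_simps)
  qed
  have c_pos: "c l > 0" for l
    using alpha rows_nonzero by (simp add: c_def)
  have energy: "(norm (T l E))\<^sup>2 \<le> (norm E)\<^sup>2
      - c l * (2 - \<alpha> * (spectral_norm B)\<^sup>2) * (norm (P l ** E ** B))\<^sup>2" for l E
  proof -
    define D where "D = P l ** E ** B"
    define G where "G = transpose (P l) ** D ** transpose B"
    have EG: "E \<bullet> G = (norm D)\<^sup>2"
      unfolding G_def power2_norm_eq_inner
      using inner_matrix_mult_right[of "transpose (P l) ** D" "transpose B" E]
        inner_matrix_mult_left[of "transpose (P l)" D "E ** B"]
      by (simp add: inner_commute[of E] D_def matrix_mul_assoc)
    have "(norm G)\<^sup>2 = (D ** transpose B) \<bullet> (P l ** (transpose (P l) ** (D ** transpose B)))"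
      unfolding power2_norm_eq_inner G_def
      by (simp add: inner_matrix_mult_left flip: matrix_mul_assoc)
    also have "P l ** (transpose (P l) ** (D ** transpose B)) = (norm (row l A))\<^sup>2 *\<^sub>R (D ** transpose B)"
      by (simp add: matrix_mul_assoc row_mat_mult_transpose P_def flip: scalar_matrix_assoc)
    \<comment> \<open>The squared row norm in the denominator of \<open>c l\<close> cancels the one
      from \<open>P l ** transpose (P l)\<close>.\<close>
    finally have "c l * (norm G)\<^sup>2 = \<alpha> * (norm (D ** transpose B))\<^sup>2"
      using rows_nonzero[of l] by (simp add: c_def power2_norm_eq_inner)
    also have "\<dots> \<le> \<alpha> * (spectral_norm B * norm D)\<^sup>2"
      using alpha(1) by (intro mult_left_mono power_mono norm_matrix_mult_transpose_le) auto
    finally have "c l * (c l * (norm G)\<^sup>2) \<le> c l * (\<alpha> * (spectral_norm B * norm D)\<^sup>2)"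
      using c_pos[of l] by (intro mult_left_mono) auto
    moreover have "(norm (T l E))\<^sup>2 = (norm E)\<^sup>2 - 2 * c l * (norm D)\<^sup>2 + c l * (c l * (norm G)\<^sup>2)"
      unfolding T_def D_def[symmetric] G_def[symmetric]
      by (simp add: power2_norm_eq_inner inner_diff inner_commute[of G E] EG[unfolded power2_norm_eq_inner]
          right_diff_distrib)
    ultimately show ?thesis
      unfolding D_def by (simp add: algebra_simps power_mult_distrib)
  qed
  \<comment> \<open>Clearing the denominator in the bound on \<open>\<alpha>\<close> needs a nonzero
    norm; in the other case the claim reads \<open>2 > 0\<close>.\<close>
  have pos: "2 - \<alpha> * (spectral_norm B)\<^sup>2 > 0"
    using alpha by (cases "spectral_norm B = 0") (auto simp: field_simps)
  have T_fixed: "T l E = E" if "P l ** E ** B = 0" for l E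
    using that by (simp add: T_def linear_0[OF linear_matrix_sandwich])
  have nonexp: "norm (T l E) \<le> norm E" for l E
    by (rule power2_le_imp_le, rule order_trans[OF energy])
       (use c_pos[of l] pos in auto)
  \<comment> \<open>A vanishing residual serves twice: it makes \<open>E\<close> a fixed point, and
    collected over all rows it gives \<open>A ** E ** B = 0\<close>.\<close>
  have strict: "P l ** E ** B = 0" if "norm (T l E) = norm E" for l E
  proof -
    have "c l * (2 - \<alpha> * (spectral_norm B)\<^sup>2) * (norm (P l ** E ** B))\<^sup>2 \<le> 0"
      using energy[of l E] that by simp
    then show ?thesis
      using c_pos[of l] pos by (auto simp: mult_le_0_iff)
  qed
  have "(\<lambda>k. X k - L) \<longlonglongrightarrow> 0"
  proof (rule periodic_nonexpansive_tendsto_0[where T = "\<lambda>k. T (i k)" and S = "{E. F E = E}"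
        and N = "CARD('m)"])
    show "closed {E. F E = E}"
      using lin_F by (intro closed_Collect_eq linear_continuous_on continuous_on_id)
        (simp add: linear_conv_bounded_linear)
    show "T (i k) E \<in> {E. F E = E}" if "E \<in> {E. F E = E}" for k E
      using that by (simp add: T_def linear_diff[OF lin_F] linear_scale[OF lin_F] F_update)
    have "linear (T l)" for l
    proof -
      have "T l = (\<lambda>E. E - c l *\<^sub>R ((transpose (P l) ** P l) ** E ** (B ** transpose B)))"
        by (simp add: T_def fun_eq_iff matrix_mul_assoc)
      then show ?thesis
        by (simp only: linear_compose_sub linear_compose_scale_right linear_ident linear_matrix_sandwich)
    qed
    then show "continuous_on UNIV (T (i k))" for k
      by (simp add: linear_continuous_on linear_conv_bounded_linear)
    \<comment> \<open>The initial error is \<open>F X0 - F Y\<close>, which lies in the range of the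
      idempotent \<open>F\<close>.\<close>
    show "X 0 - L \<in> {E. F E = E}"
      unfolding X_init L by (simp add: linear_diff[OF lin_F] linear_add[OF lin_F] FF)
    show "T (i (k + CARD('m))) = T (i k)" for k
      by (simp add: cyclic)
    show "T (i k) E = E" if "norm (T (i k) E) = norm E" for k E
      using that strict T_fixed by blast
    show "E = 0" if "E \<in> {E. F E = E}" and fixed: "\<And>k. T (i k) E = E" for E
    proof -
      have "P l ** E ** B = 0" for l
      proof -
        obtain j where "j \<in> {1..CARD('m)}" "r j = l"
          using enum by (metis UNIV_I bij_betw_iff_bijections)
        \<comment> \<open>The enumeration starts at 1 but the iteration count at 0;
          \<open>j - 1\<close> is below \<open>CARD('m)\<close>, so the remainder leaves it
          unchanged.\<close>
        then have "i (j - 1) = l"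
          by (auto simp: cyclic)
        then show ?thesis
          using fixed[of "j - 1"] strict[of l E] by simp
      qed
      then have "A ** E ** B = 0"
        unfolding P_def row_mat_mult[symmetric] matrix_eq_0_iff_row_mat[of "A ** E ** B"] by blast
      \<comment> \<open>On the range of \<open>F\<close> the product \<open>A ** E ** B\<close>
        determines \<open>E\<close>.\<close>
      moreover have "F E = pinv A ** (A ** E ** B) ** pinv B"
        by (simp add: F_def matrix_mul_assoc)
      ultimately have "F E = 0"
        by (simp add: linear_0[OF linear_matrix_sandwich])
      with that show ?thesis by simp
    qed
  qed (use nonexp step in auto)
  then have "X \<longlonglongrightarrow> L"
    by (simp add: LIM_zero_iff)
  then show ?thesis
    by (simp add: L_def F_def matrix_mul_assoc)
qed

end
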